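(* Let $\mathbf{U},\mathbf{V}\in\mathbb{R}^{MN}$ satisfy the fully discrete approximation described in the context (with homogeneous boundary data), where the discrete time derivative operators $D_t^{(i)},D_t^{(j)}$ ($i,j\in\{1,2\}$) satisfy Assumptions (A.1)-(A.2) in time and (B.1). Suppose the penalty parameters satisfy $\mu_1<-1/2$, $\mu_3<-1/2$, $\mu_2=\mu_1$, $\mu_4=-\mu_1\mu_3$, and suppose that the source vanishes, $\mathbf{S}_k=\mathbf{0}$ for $k=1,\dots,M$. Then there is a non-dimensional constant $C>0$, independent of the space-time grid parameters, such that for all $\Delta t>0$ $$\mathcal{E}_M+\sum_{k=1}^M h_k\left(\|\mathbf{c}^{-1}\pmb{\sigma}\mathbf{V}_k\|_{H_x}^2+\operatorname{BT}_{hk}\right)\Delta t\le C\,\mathcal{E}_0,$$ where $\operatorname{BT}_{hk}=\frac{\beta_R}{\alpha_R}V_{kN}^2-\frac{\beta_L}{\alpha_L}V_{k1}^2\ge 0$ and $h_k>0$ are the (non-dimensional) quadrature weights of $H_t$.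
   Context: Space grid: $\Omega=[x_L,x_R]$, uniform points $x_1=x_L,\dots,x_N=x_R$, $\Delta x=(x_R-x_L)/(N-1)$. A triplet $(D_x^-,D_x^+,H_x)$ of $N\times N$ matrices satisfies the DP-SBP framework if: (A.1) $H_x=\operatorname{diag}(h_1\Delta x,\dots,h_N\Delta x)$ is diagonal and positive definite, defines $(\mathbf f,\mathbf g)_{H_x}=\mathbf f^\top H_x\mathbf g$ and $\|\mathbf f\|_{H_x}^2=(\mathbf f,\mathbf f)_{H_x}$, and $(\mathbf 1,\mathbf f)_{H_x}=\sum_i h_if(x_i)\Delta x$ is a quadrature converging to $\int_\Omega f\,dx$ as $N\to\infty$; (A.2) $D_x^\pm$ differentiate grid restrictions of polynomials of degree at most $p$ exactly; (A.3) $(D_x^+\mathbf f,\mathbf g)_{H_x}+(\mathbf f,D_x^-\mathbf g)_{H_x}=f_Ng_N-f_1g_1$ for all $\mathbf f,\mathbf g\in\mathbb R^N$; (A.4) $(\mathbf f,(D_x^+-D_x^-)\mathbf f)_{H_x}\le 0$ for all $\mathbf f$. Time grid: $[0,T]$ with uniform points $t_1=0,\dots,t_M=T$, $\Delta t=T/(M-1)$. $H_t=\operatorname{diag}(h_1\Delta t,\dots,h_M\Delta t)$ is positive definite (the weights $h_k$ in sums over $k$ are those of $H_t$), and $D_t^{(1)},D_t^{(2)}\in\mathbb R^{M\times M}$ are discrete first derivatives in time such that $(H_t,D_t^{(j)})$ satisfies the analogues of (A.1)-(A.2) in time and (B.1): with $Q_t^{(j)}=H_tD_t^{(j)}-\frac12(e_Me_M^\top-e_1e_1^\top)$,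 the matrix $S_t^{(j)}=Q_t^{(j)}+(Q_t^{(j)})^\top$ satisfies $\mathbf f^\top S_t^{(j)}\mathbf f\ge0$ for all $\mathbf f\in\mathbb R^M$. Here $e_1,e_M\in\mathbb{R}^M$ (and $e_1,e_N\in\mathbb R^N$ in space) are the first and last standard basis vectors. Coefficients: $\mathbf c=\operatorname{diag}(c(x_1),\dots,c(x_N))$ with $c(x)\ne0$, $\pmb\sigma=\operatorname{diag}(\sigma(x_1),\dots,\sigma(x_N))$ (real). Real boundary parameters satisfy $\alpha_L\ne0$, $\alpha_R\ne0$, $\alpha_L\beta_L\le0$, $\alpha_R\beta_R\ge0$. Put $\widetilde D_{xx}=-H_x^{-1}(D_x^-)^\top H_xD_x^-$ and $B=H_x^{-1}\mathbf c^2\left(\frac{\beta_R}{\alpha_R}e_Ne_N^\top-\frac{\beta_L}{\alpha_L}e_1e_1^\top\right)$. Unknown: $\mathbf U=[\mathbf U_1^\top\cdots\mathbf U_M^\top]^\top\in\mathbb R^{MN}$, $\mathbf U_k=[U_{k1},\dots,U_{kN}]^\top$ (similarly for $\mathbf V$). Initial data $\mathbf f,\mathbf g\in\mathbb R^N$, $\mathbf F=(e_1\otimes I_x)\mathbf f$, $\mathbf G=(e_1\otimes I_x)\mathbf g$. $\bar{\mathbf S}\in\mathbb R^{MN}$ has blocks $\mathbf S_k=\mathbf S(t_k)$, the source sampled on the grid (homogeneous boundary data give no further contribution). The fully discrete approximation is $$(D_t^{(i)}D_t^{(j)}\otimes I_x)\mathbf U+(D_t^{(j)}\otimes(\pmb\sigma^2+B))\mathbf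 U-(I_t\otimes\mathbf c^2\widetilde D_{xx})\mathbf U=\operatorname{SAT}+\bar{\mathbf S},$$ $$\operatorname{SAT}=\mu_1(H_t^{-1}e_1e_1^\top\otimes(\pmb\sigma^2+B))(\mathbf U-\mathbf F)+\mu_2(D_t^{(i)}H_t^{-1}e_1e_1^\top\otimes I_x)(\mathbf U-\mathbf F)+\mu_3(H_t^{-1}e_1e_1^\top\otimes I_x)\left((D_t^{(j)}\otimes I_x)\mathbf U-\mathbf G\right)+\mu_4(H_t^{-1}e_1e_1^\top H_t^{-1}e_1e_1^\top\otimes I_x)(\mathbf U-\mathbf F),$$ or equivalently (when $\mu_2=\mu_1$, $\mu_4=-\mu_1\mu_3$), with an auxiliary field $\mathbf V$, $$\mathbf V=(D_t^{(j)}\otimes I_x)\mathbf U-\mu_1(H_t^{-1}e_1e_1^\top\otimes I_x)(\mathbf U-\mathbf F),$$ $$(D_t^{(i)}\otimes I_x)\mathbf V+(I_t\otimes(\pmb\sigma^2+B))\mathbf V=(I_t\otimes\mathbf c^2\widetilde D_{xx})\mathbf U+\mu_3(H_t^{-1}e_1e_1^\top\otimes I_x)(\mathbf V-\mathbf G)+\bar{\mathbf S}.$$ Discrete energy: $\mathcal E_k=\frac12\left(\|\mathbf c^{-1}\mathbf V_k\|_{H_x}^2+\|D_x^-\mathbf U_k\|_{H_x}^2\right)$ for $k=1,\dots,M$, and $\mathcal E_0=\frac12\left(\|\mathbf c^{-1}\mathbf g\|_{H_x}^2+\|D_x^-\mathbf f\|_{H_x}^2\right)$. *)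

theory Defs
  imports
    "HOL-Analysis.Henstock_Kurzweil_Integration"
    "Jordan_Normal_Form.Gauss_Jordan_Elimination"
    "HOL-Computational_Algebra.Polynomial"
begin

no_notation inner (infix \<open>\<bullet>\<close> 70)

text \<open>Grid sizes vary inside the statements, so vectors and matrices are those of
  Jordan_Normal_Form. Indices start at 0: the grid points $x_1,\dots,x_n$ are
  \<open>grid_pt a b n 0, \<dots>, grid_pt a b n (n - 1)\<close>.\<close>

subsection \<open>Linear algebra\<close>

text \<open>Only applied to nonsingular (in fact diagonal) matrices; the value is unspecified otherwise.\<close>
definition mat_inv :: "real mat \<Rightarrow> real mat" where
  "mat_inv A = the (mat_inverse A)"

definition kron :: "real mat \<Rightarrow> real mat \<Rightarrow> real mat" (infixl \<open>\<otimes>\<^sub>K\<close> 72) where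
  "A \<otimes>\<^sub>K B = mat (dim_row A * dim_row B) (dim_col A * dim_col B)
     (\<lambda>(r, s). A $$ (r div dim_row B, s div dim_col B) * B $$ (r mod dim_row B, s mod dim_col B))"

definition basis_col :: "nat \<Rightarrow> nat \<Rightarrow> real mat" where
  "basis_col n i = mat_of_cols n [unit_vec n i]"

text \<open>The rank-one matrix $e_{i+1} e_{i+1}^\top$.\<close>
definition proj :: "nat \<Rightarrow> nat \<Rightarrow> real mat" where
  "proj n i = basis_col n i * (basis_col n i)\<^sup>T"

definition pos_def :: "nat \<Rightarrow> real mat \<Rightarrow> bool" where
  "pos_def n A \<longleftrightarrow> A \<in> carrier_mat n n \<and> A\<^sup>T = A \<and>
     (\<forall>v \<in> carrier_vec n. v \<noteq> 0\<^sub>v n \<longrightarrow> v \<bullet> (A *\<^sub>v v) > 0)"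

definition ip :: "real mat \<Rightarrow> real vec \<Rightarrow> real vec \<Rightarrow> real" where
  "ip H f g = f \<bullet> (H *\<^sub>v g)"

definition sqnorm :: "real mat \<Rightarrow> real vec \<Rightarrow> real" where
  "sqnorm H f = ip H f f"

text \<open>The block $U_{k+1} \in R^N$ of a stacked vector $U \in R^{MN}$.\<close>
definition block :: "nat \<Rightarrow> nat \<Rightarrow> real vec \<Rightarrow> real vec" where
  "block N k U = vec N (\<lambda>i. U $ (k * N + i))"

subsection \<open>Grids and summation-by-parts operators\<close>

definition grid_step :: "real \<Rightarrow> real \<Rightarrow> nat \<Rightarrow> real" where
  "grid_step a b n = (b - a) / (real n - 1)"

definition grid_pt :: "real \<Rightarrow> real \<Rightarrow> nat \<Rightarrow> nat \<Rightarrow> real" where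
  "grid_pt a b n i = a + real i * grid_step a b n"

definition grid_vec :: "real \<Rightarrow> real \<Rightarrow> nat \<Rightarrow> (real \<Rightarrow> real) \<Rightarrow> real vec" where
  "grid_vec a b n f = vec n (\<lambda>i. f (grid_pt a b n i))"

definition grid_diag :: "real \<Rightarrow> real \<Rightarrow> nat \<Rightarrow> (real \<Rightarrow> real) \<Rightarrow> real mat" where
  "grid_diag a b n f = mat_diag n (\<lambda>i. f (grid_pt a b n i))"

text \<open>\<open>h n i\<close> is the non-dimensional weight at the point with index \<open>i\<close> of the grid with
  \<open>n\<close> points.\<close>
definition norm_mat :: "real \<Rightarrow> real \<Rightarrow> (nat \<Rightarrow> nat \<Rightarrow> real) \<Rightarrow> nat \<Rightarrow> real mat" where
  "norm_mat a b h n = mat_diag n (\<lambda>i. h n i * grid_step a b n)"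

text \<open>Convergence of the quadrature concerns $n \to \infty$, so the operators are given as families
  indexed by the number \<open>n\<close> of grid points; \<open>n0\<close> is the smallest number of points for which
  the operators are available.\<close>
definition quadrature_norm ::
  "real \<Rightarrow> real \<Rightarrow> nat \<Rightarrow> (nat \<Rightarrow> nat \<Rightarrow> real) \<Rightarrow> bool" where
  "quadrature_norm a b n0 h \<longleftrightarrow>
     (\<forall>n\<ge>n0. pos_def n (norm_mat a b h n)) \<and>
     (\<forall>f. continuous_on {a..b} f \<longrightarrow>
        (\<lambda>n. ip (norm_mat a b h n) (grid_vec a b n (\<lambda>x. 1)) (grid_vec a b n f))
          \<longlonglongrightarrow> integral {a..b} f)"

definition poly_exact :: "real \<Rightarrow> real \<Rightarrow> nat \<Rightarrow> nat \<Rightarrow> real mat \<Rightarrow> bool" where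
  "poly_exact a b p n D \<longleftrightarrow>
     (\<forall>q. degree q \<le> p \<longrightarrow> D *\<^sub>v grid_vec a b n (poly q) = grid_vec a b n (poly (pderiv q)))"

definition dp_sbp :: "real \<Rightarrow> real \<Rightarrow> nat \<Rightarrow> nat \<Rightarrow> (nat \<Rightarrow> real mat) \<Rightarrow> (nat \<Rightarrow> real mat) \<Rightarrow>
    (nat \<Rightarrow> nat \<Rightarrow> real) \<Rightarrow> bool" where
  "dp_sbp a b p n0 Dm Dp h \<longleftrightarrow>
     quadrature_norm a b n0 h \<and>
     (\<forall>n\<ge>n0. let H = norm_mat a b h n in
        Dm n \<in> carrier_mat n n \<and> Dp n \<in> carrier_mat n n \<and>
        poly_exact a b p n (Dm n) \<and> poly_exact a b p n (Dp n) \<and>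
        (\<forall>f \<in> carrier_vec n. \<forall>g \<in> carrier_vec n.
           ip H (Dp n *\<^sub>v f) g + ip H f (Dm n *\<^sub>v g) = f $ (n - 1) * g $ (n - 1) - f $ 0 * g $ 0) \<and>
        (\<forall>f \<in> carrier_vec n. ip H f ((Dp n - Dm n) *\<^sub>v f) \<le> 0))"

definition time_S :: "real mat \<Rightarrow> real mat \<Rightarrow> nat \<Rightarrow> real mat" where
  "time_S H D m = (let Q = H * D - (1 / 2) \<cdot>\<^sub>m (proj m (m - 1) - proj m 0) in Q + Q\<^sup>T)"

definition time_sbp ::
  "real \<Rightarrow> nat \<Rightarrow> nat \<Rightarrow> (nat \<Rightarrow> nat \<Rightarrow> real mat) \<Rightarrow> (nat \<Rightarrow> nat \<Rightarrow> real) \<Rightarrow> bool" where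
  "time_sbp T q m0 Dt h \<longleftrightarrow>
     quadrature_norm 0 T m0 h \<and>
     (\<forall>j\<in>{1, 2}. \<forall>m\<ge>m0.
        Dt j m \<in> carrier_mat m m \<and> poly_exact 0 T q m (Dt j m) \<and>
        (\<forall>f \<in> carrier_vec m. 0 \<le> f \<bullet> (time_S (norm_mat 0 T h m) (Dt j m) m *\<^sub>v f)))"

subsection \<open>The fully discrete approximation\<close>

definition D_xx :: "real mat \<Rightarrow> real mat \<Rightarrow> real mat" where
  "D_xx Hx Dm = - (mat_inv Hx * Dm\<^sup>T * Hx * Dm)"

definition B_mat :: "nat \<Rightarrow> real mat \<Rightarrow> real mat \<Rightarrow> real \<Rightarrow> real \<Rightarrow> real \<Rightarrow> real \<Rightarrow> real mat" where
  "B_mat N Hx cm \<alpha>L \<beta>L \<alpha>R \<beta>R =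
     mat_inv Hx * (cm ^\<^sub>m 2) * ((\<beta>R / \<alpha>R) \<cdot>\<^sub>m proj N (N - 1) - (\<beta>L / \<alpha>L) \<cdot>\<^sub>m proj N 0)"

text \<open>$(e_1 \otimes I_x) f$\<close>
definition lift_init :: "nat \<Rightarrow> nat \<Rightarrow> real vec \<Rightarrow> real vec" where
  "lift_init M N f = (basis_col M 0 \<otimes>\<^sub>K 1\<^sub>m N) *\<^sub>v f"

text \<open>\<open>s x t\<close> is the source at position \<open>x\<close> and time \<open>t\<close>.\<close>
definition source_vec ::
  "real \<Rightarrow> real \<Rightarrow> real \<Rightarrow> (real \<Rightarrow> real \<Rightarrow> real) \<Rightarrow> nat \<Rightarrow> nat \<Rightarrow> real vec" where
  "source_vec xL xR T s M N =
     vec (M * N) (\<lambda>l. s (grid_pt xL xR N (l mod N)) (grid_pt 0 T M (l div N)))"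

text \<open>In the following, \<open>Di\<close>, \<open>Dj\<close> stand for the time derivatives
  $D_t^{(i)}$, $D_t^{(j)}$, and \<open>R\<close> stands for $\sigma^2 + B$.\<close>

definition SAT :: "nat \<Rightarrow> nat \<Rightarrow> real \<Rightarrow> real \<Rightarrow> real \<Rightarrow> real \<Rightarrow> real mat \<Rightarrow> real mat \<Rightarrow> real mat \<Rightarrow>
    real mat \<Rightarrow> real vec \<Rightarrow> real vec \<Rightarrow> real vec \<Rightarrow> real vec" where
  "SAT M N \<mu>1 \<mu>2 \<mu>3 \<mu>4 Ht Di Dj R F G U =
     (let P = mat_inv Ht * proj M 0 in
        \<mu>1 \<cdot>\<^sub>v ((P \<otimes>\<^sub>K R) *\<^sub>v (U - F))
      + \<mu>2 \<cdot>\<^sub>v (((Di * P) \<otimes>\<^sub>K 1\<^sub>m N) *\<^sub>v (U - F))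
      + \<mu>3 \<cdot>\<^sub>v ((P \<otimes>\<^sub>K 1\<^sub>m N) *\<^sub>v ((Dj \<otimes>\<^sub>K 1\<^sub>m N) *\<^sub>v U - G))
      + \<mu>4 \<cdot>\<^sub>v (((P * P) \<otimes>\<^sub>K 1\<^sub>m N) *\<^sub>v (U - F)))"

definition fully_discrete :: "nat \<Rightarrow> nat \<Rightarrow> real \<Rightarrow> real \<Rightarrow> real \<Rightarrow> real \<Rightarrow> real mat \<Rightarrow> real mat \<Rightarrow>
    real mat \<Rightarrow> real mat \<Rightarrow> real mat \<Rightarrow> real mat \<Rightarrow> real vec \<Rightarrow> real vec \<Rightarrow> real vec \<Rightarrow> real vec \<Rightarrow> bool"
  where
  "fully_discrete M N \<mu>1 \<mu>2 \<mu>3 \<mu>4 Ht Di Dj R cm Dxx F G Sbar U \<longleftrightarrow>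
     ((Di * Dj) \<otimes>\<^sub>K 1\<^sub>m N) *\<^sub>v U + (Dj \<otimes>\<^sub>K R) *\<^sub>v U - (1\<^sub>m M \<otimes>\<^sub>K ((cm ^\<^sub>m 2) * Dxx)) *\<^sub>v U
     = SAT M N \<mu>1 \<mu>2 \<mu>3 \<mu>4 Ht Di Dj R F G U + Sbar"

definition aux_field ::
  "nat \<Rightarrow> nat \<Rightarrow> real \<Rightarrow> real mat \<Rightarrow> real mat \<Rightarrow> real vec \<Rightarrow> real vec \<Rightarrow> real vec" where
  "aux_field M N \<mu>1 Ht Dj F U =
     (Dj \<otimes>\<^sub>K 1\<^sub>m N) *\<^sub>v U - \<mu>1 \<cdot>\<^sub>v (((mat_inv Ht * proj M 0) \<otimes>\<^sub>K 1\<^sub>m N) *\<^sub>v (U - F))"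

definition energy :: "real mat \<Rightarrow> real mat \<Rightarrow> real mat \<Rightarrow> real vec \<Rightarrow> real vec \<Rightarrow> real" where
  "energy Hx cm Dm u v = (sqnorm Hx (mat_inv cm *\<^sub>v v) + sqnorm Hx (Dm *\<^sub>v u)) / 2"

definition BT :: "nat \<Rightarrow> real \<Rightarrow> real \<Rightarrow> real \<Rightarrow> real \<Rightarrow> real vec \<Rightarrow> real" where
  "BT N \<alpha>L \<beta>L \<alpha>R \<beta>R v = \<beta>R / \<alpha>R * (v $ (N - 1))\<^sup>2 - \<beta>L / \<alpha>L * (v $ 0)\<^sup>2"

end

theory Submission
  imports Defs
begin

unbundle no vec_syntax

text \<open>
  Reading a stacked vector \<open>U\<close> as an \<open>M \<times> N\<close> matrix \<open>X\<close> turns \<open>(A \<otimes>\<^sub>K B) *\<^sub>v U\<close> into \<open>A * X * B\<^sup>T\<close>: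
  time operators act on columns, space operators on rows. Testing the first-order system with
  \<open>V\<close> in the weights \<open>w i / (c i)\<^sup>2\<close>, and \<open>D * V\<close> with \<open>D * U\<close> in the weights \<open>w i\<close>, the spatial
  coupling terms cancel and leave the damping and boundary terms. In each column the time
  quadrature of \<open>x\<close> against its penalised derivative is at least \<open>x\<^sub>M\<^sup>2 / 2 - x\<^sub>1\<^sup>2 / 2 - \<mu> x\<^sub>1 (x\<^sub>1 - x\<^sub>0)\<close>
  with datum \<open>x\<^sub>0\<close>; for \<open>\<mu> < -1/2\<close>, completing the square bounds the terms in \<open>x\<^sub>1\<close> below by
  \<open>- \<mu>\<^sup>2 / (- 4 \<mu> - 2) x\<^sub>0\<^sup>2\<close>.
\<close>

section \<open>Diagonal matrices, their inverses and weighted inner products\<close>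

lemma mat_diag_index [simp]:
  "i < n \<Longrightarrow> j < n \<Longrightarrow> mat_diag n d $$ (i, j) = (if i = j then d j else 0)"
  by (simp add: mat_diag_def)

lemma dim_mat_diag [simp]: "dim_row (mat_diag n d) = n" "dim_col (mat_diag n d) = n"
  by (simp_all add: mat_diag_def)

lemma mat_diag_mult_vec:
  fixes d :: "nat \<Rightarrow> 'a :: comm_semiring_0"
  assumes "x \<in> carrier_vec n"
  shows "mat_diag n d *\<^sub>v x = vec n (\<lambda>i. d i * x $ i)"
  using assms
  by (intro eq_vecI)
    (auto simp: scalar_prod_def if_distrib[of "\<lambda>t. t * _"] sum.delta cong: if_cong)

lemma mat_diag_cong: "(\<And>i. i < n \<Longrightarrow> d i = e i) \<Longrightarrow> mat_diag n d = mat_diag n e"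
  by (auto simp: mat_diag_def)

lemma mat_diag_sq: "mat_diag n d ^\<^sub>m 2 = mat_diag n (\<lambda>i. (d i :: real)\<^sup>2)"
  by (simp add: numeral_2_eq_2 left_mult_one_mat[OF mat_diag_dim])

text \<open>\<open>mat_inv\<close> is the value of an option, so the explicit two-sided inverse is
  first used to show that the matrix is a unit, which excludes \<open>None\<close>. The matrix
  returned is a left inverse and hence equals the explicit right inverse.\<close>

lemma mat_inv_mat_diag:
  assumes d: "\<And>i. i < n \<Longrightarrow> d i \<noteq> (0 :: real)"
  shows "mat_inv (mat_diag n d) = mat_diag n (\<lambda>i. 1 / d i)"
proof -
  have "mat_diag n (\<lambda>i. d i * (1 / d i)) = 1\<^sub>m n" "mat_diag n (\<lambda>i. 1 / d i * d i) = 1\<^sub>m n"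
    unfolding mat_diag_one[symmetric] by (rule mat_diag_cong, use d in simp)+
  then have one: "mat_diag n d * mat_diag n (\<lambda>i. 1 / d i) = 1\<^sub>m n"
            "mat_diag n (\<lambda>i. 1 / d i) * mat_diag n d = 1\<^sub>m n"
    by (simp_all only: mat_diag_diag)
  have "mat_diag n d \<in> Units (ring_mat TYPE(real) n ())"
    unfolding Units_def using one by (auto simp: ring_mat_def intro!: bexI[of _ "mat_diag n (\<lambda>i. 1 / d i)"])
  then obtain B where B: "mat_inverse (mat_diag n d) = Some B"
    using mat_inverse(1)[OF mat_diag_dim, of n d "()"] by (cases "mat_inverse (mat_diag n d)") auto
  then have B': "B \<in> carrier_mat n n" "B * mat_diag n d = 1\<^sub>m n"
    using mat_inverse(2)[OF mat_diag_dim B] by auto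
  have "B = B * (mat_diag n d * mat_diag n (\<lambda>i. 1 / d i))"
    using B' one by simp
  also have "\<dots> = (B * mat_diag n d) * mat_diag n (\<lambda>i. 1 / d i)"
    using B'(1) by (simp add: assoc_mult_mat[OF _ mat_diag_dim mat_diag_dim] del: mat_diag_diag)
  also have "\<dots> = mat_diag n (\<lambda>i. 1 / d i)"
    unfolding B'(2) by (rule left_mult_one_mat[OF mat_diag_dim])
  finally show ?thesis
    by (simp add: mat_inv_def B)
qed

lemma ip_mat_diag:
  assumes "f \<in> carrier_vec n" "g \<in> carrier_vec n"
  shows "ip (mat_diag n d) f g = (\<Sum>i<n. d i * f $ i * g $ i)"
  using assms by (auto simp: ip_def mat_diag_mult_vec scalar_prod_def lessThan_atLeast0 intro!: sum.cong)

lemma sqnorm_mat_diag: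
  "f \<in> carrier_vec n \<Longrightarrow> sqnorm (mat_diag n d) f = (\<Sum>i<n. d i * (f $ i)\<^sup>2)"
  by (simp add: sqnorm_def ip_mat_diag power2_eq_square mult.assoc)

lemma pos_def_mat_diagD:
  assumes "pos_def n (mat_diag n d)" "i < n"
  shows "d i > 0"
proof -
  have "unit_vec n i \<bullet> (mat_diag n d *\<^sub>v unit_vec n i) > 0"
    using assms by (auto simp: pos_def_def)
  then show ?thesis
    using assms(2) by (simp add: mat_diag_mult_vec)
qed

section \<open>Standard basis columns and rank-one projections\<close>

lemma basis_col_carrier [simp]: "basis_col n i \<in> carrier_mat n 1"
  by (simp add: basis_col_def mat_of_cols_def)

lemma basis_col_index [simp]: "k < n \<Longrightarrow> basis_col n i $$ (k, 0) = (if k = i then 1 else 0)"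
  by (simp add: basis_col_def mat_of_cols_def unit_vec_def)

lemma dim_basis_col [simp]: "dim_row (basis_col n i) = n" "dim_col (basis_col n i) = 1"
  by (simp_all add: basis_col_def)

lemma smult_mat_mult_vec:
  fixes a :: "'a :: comm_semiring_0"
  shows "x \<in> carrier_vec (dim_col A) \<Longrightarrow> (a \<cdot>\<^sub>m A) *\<^sub>v x = a \<cdot>\<^sub>v (A *\<^sub>v x)"
  by (intro eq_vecI) (auto simp: scalar_prod_def sum_distrib_left mult.assoc)

lemma proj_eq_mat_diag: 
  assumes "i < n" shows "proj n i = mat_diag n (\<lambda>k. if k = i then 1 else 0)"
  using assms
  by (intro eq_matI) (auto simp: proj_def scalar_prod_def)

section \<open>Stacked vectors as matrices, and Kronecker products\<close>

text \<open>Row-major reading: rows are time levels and columns are space points, in agreement with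
  \<open>block\<close> and with the div/mod indexing of \<open>kron\<close>.\<close>

definition unvec :: "nat \<Rightarrow> nat \<Rightarrow> 'a vec \<Rightarrow> 'a mat" where
  "unvec M N U = mat M N (\<lambda>(k, i). U $ (k * N + i))"

lemma unvec_carrier [simp]: "unvec M N U \<in> carrier_mat M N"
  by (simp add: unvec_def)

lemma block_index_less: "k < M \<Longrightarrow> i < N \<Longrightarrow> k * N + i < M * (N :: nat)"
  using mult_le_mono1[of "Suc k" M N] by simp

lemma unvec_add:
  assumes "W \<in> carrier_vec (M * N)"
  shows "unvec M N (U + W) = unvec M N U + unvec M N W"
  using assms by (intro eq_matI) (auto simp: unvec_def block_index_less)

lemma unvec_diff:
  assumes "W \<in> carrier_vec (M * N)"
  shows "unvec M N (U - W) = unvec M N U - unvec M N W"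
  using assms by (intro eq_matI) (auto simp: unvec_def block_index_less)

lemma unvec_smult:
  assumes "W \<in> carrier_vec (M * N)"
  shows "unvec M N (a \<cdot>\<^sub>v W) = a \<cdot>\<^sub>m unvec M N W"
  using assms by (intro eq_matI) (auto simp: unvec_def block_index_less)

lemma row_unvec: "k < M \<Longrightarrow> row (unvec M N U) k = block N k U"
  by (auto simp: unvec_def block_def)

lemma sum_blocks:
  fixes h :: "nat \<Rightarrow> 'a :: comm_monoid_add"
  shows "(\<Sum>r<m * n. h r) = (\<Sum>k<m. \<Sum>i<n. h (k * n + i))"
proof -
  have "(\<Sum>i<n. h (k * n + i)) = sum h {k * n..<k * n + n}" for k
    using sum.shift_bounds_nat_ivl[of h 0 "k * n" n] by (simp add: lessThan_atLeast0 add.commute)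
  then show ?thesis
    by (simp only: sum.nat_group)
qed

lemma kron_carrier:
  "A \<in> carrier_mat m m' \<Longrightarrow> B \<in> carrier_mat n n' \<Longrightarrow> A \<otimes>\<^sub>K B \<in> carrier_mat (m * n) (m' * n')"
  by (auto simp: kron_def)

text \<open>The matrix form of a Kronecker product acting on a stacked vector. The row-major
  convention places the first factor on the left and the transpose of the second on the
  right.\<close>

lemma unvec_kron_mult:
  assumes A: "A \<in> carrier_mat m m'" and B: "B \<in> carrier_mat n n'" and U: "U \<in> carrier_vec (m' * n')"
  shows "unvec m n ((A \<otimes>\<^sub>K B) *\<^sub>v U) = A * unvec m' n' U * B\<^sup>T"
proof (rule eq_matI)
  fix k i assume "k < dim_row (A * unvec m' n' U * B\<^sup>T)" "i < dim_col (A * unvec m' n' U * B\<^sup>T)"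
  then have k: "k < m" and i: "i < n" using A B by auto
  have "unvec m n ((A \<otimes>\<^sub>K B) *\<^sub>v U) $$ (k, i) = (\<Sum>r<m' * n'. A $$ (k, r div n') * B $$ (i, r mod n') * U $ r)"
    using A B U k i block_index_less[OF k i]
    by (auto simp: unvec_def kron_def scalar_prod_def lessThan_atLeast0 intro!: sum.cong)
  \<comment> \<open>Writing \<open>r = l * n' + j\<close>, the quotient and remainder of
    \<open>r\<close> by \<open>n'\<close> are the time index \<open>l\<close> and the space index
    \<open>j\<close>.\<close>
  also have "\<dots> = (\<Sum>l<m'. \<Sum>j<n'. A $$ (k, l) * B $$ (i, j) * U $ (l * n' + j))"
    unfolding sum_blocks by (intro sum.cong refl) auto
  also have "\<dots> = (\<Sum>j<n'. \<Sum>l<m'. A $$ (k, l) * B $$ (i, j) * U $ (l * n' + j))"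
    by (rule sum.swap)
  also have "\<dots> = (A * unvec m' n' U * B\<^sup>T) $$ (k, i)"
    using A B k i
    by (auto simp: unvec_def scalar_prod_def lessThan_atLeast0 sum_distrib_left sum_distrib_right mult_ac intro!: sum.cong)
  finally show "unvec m n ((A \<otimes>\<^sub>K B) *\<^sub>v U) $$ (k, i) = (A * unvec m' n' U * B\<^sup>T) $$ (k, i)" .
qed (use A B in \<open>auto simp: unvec_def\<close>)

lemma lift_init_carrier: "lift_init M N f \<in> carrier_vec (M * N)"
  by (rule carrier_vecI) (simp add: lift_init_def kron_def)

lemma unvec_lift_init:
  assumes f: "f \<in> carrier_vec N"
  shows "unvec M N (lift_init M N f) = mat M N (\<lambda>(k, i). if k = 0 then f $ i else 0)"
proof -
  \<comment> \<open>Since \<open>basis_col M 0\<close> has one column, \<open>f\<close> is read as a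
    single time level, that is, as a matrix with one row.\<close>
  have "unvec M N (lift_init M N f) = basis_col M 0 * unvec 1 N f * 1\<^sub>m N"
    unfolding lift_init_def by (subst unvec_kron_mult[OF basis_col_carrier]) (use f in auto)
  also have "\<dots> = basis_col M 0 * unvec 1 N f"
    by (rule right_mult_one_mat[OF mult_carrier_mat[OF basis_col_carrier unvec_carrier]])
  also have "\<dots> = mat M N (\<lambda>(k, i). if k = 0 then f $ i else 0)"
    by (intro eq_matI) (auto simp: unvec_def scalar_prod_def)
  finally show ?thesis .
qed

section \<open>Time discretisation: summation by parts, penalties and reduction to first
  order\<close>

text \<open>A matrix and its transpose have the same quadratic form, so the form of \<open>Q\<close>
  is half that of \<open>time_S\<close> and therefore nonnegative. Moving the boundary part of
  \<open>Q\<close> to the other side leaves half the difference of the squared end values.\<close>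

lemma time_S_nonneg_imp_sbp:
  assumes m: "0 < m" and D: "D \<in> carrier_mat m m" and x: "x \<in> carrier_vec m"
    and S: "0 \<le> x \<bullet> (time_S (mat_diag m w) D m *\<^sub>v x)"
  shows "((x $ (m - 1))\<^sup>2 - (x $ 0)\<^sup>2) / 2 \<le> (\<Sum>k<m. w k * x $ k * (D *\<^sub>v x) $ k)"
proof -
  \<comment> \<open>A difference of two indicators, so that the case \<open>m = 1\<close>, where
    both ends coincide, correctly gives 0.\<close>
  define E where "E = mat_diag m (\<lambda>k. (if k = m - 1 then 1 else 0) - (if k = 0 then 1 else (0::real)))"
  define Q where "Q = mat_diag m w * D - (1 / 2) \<cdot>\<^sub>m E"
  have carr: "E \<in> carrier_mat m m" "Q \<in> carrier_mat m m"
    using D by (auto simp: E_def Q_def mat_diag_def)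
  have "proj m (m - 1) - proj m 0 = E"
    using m by (auto simp: proj_eq_mat_diag E_def mat_diag_def)
  then have "time_S (mat_diag m w) D m = Q + Q\<^sup>T"
    by (simp add: time_S_def Q_def Let_def)
  moreover have "x \<bullet> (Q\<^sup>T *\<^sub>v x) = x \<bullet> (Q *\<^sub>v x)"
    using transpose_vec_mult_scalar[of Q m m x x] carr x
    by (simp add: comm_scalar_prod[of x m])
  ultimately have "0 \<le> x \<bullet> (Q *\<^sub>v x)"
    using S carr x by (simp add: add_mult_distrib_mat_vec[of _ m m] scalar_prod_add_distrib[of _ m])
  also have "x \<bullet> (Q *\<^sub>v x) = x \<bullet> (mat_diag m w *\<^sub>v (D *\<^sub>v x)) - x \<bullet> ((1 / 2) \<cdot>\<^sub>v (E *\<^sub>v x))"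
  proof -
    have "Q *\<^sub>v x = mat_diag m w *\<^sub>v (D *\<^sub>v x) - (1 / 2) \<cdot>\<^sub>v (E *\<^sub>v x)"
      unfolding Q_def
      by (subst minus_mult_distrib_mat_vec[of _ m m])
        (use D carr x in \<open>auto simp: smult_mat_mult_vec assoc_mult_mat_vec[OF mat_diag_dim D x]\<close>)
    moreover have "mat_diag m w *\<^sub>v (D *\<^sub>v x) \<in> carrier_vec m" "(1 / 2) \<cdot>\<^sub>v (E *\<^sub>v x) \<in> carrier_vec m"
      using mult_mat_vec_carrier[OF mat_diag_dim mult_mat_vec_carrier[OF D x]]
        mult_mat_vec_carrier[OF carr(1) x] by auto
    ultimately show ?thesis
      by (simp only: scalar_prod_minus_distrib[OF x])
  qed
  also have "x \<bullet> (mat_diag m w *\<^sub>v (D *\<^sub>v x)) = (\<Sum>k<m. w k * x $ k * (D *\<^sub>v x) $ k)"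
    using ip_mat_diag[of x m "D *\<^sub>v x" w] D x by (simp add: ip_def)
  also have "x \<bullet> ((1 / 2) \<cdot>\<^sub>v (E *\<^sub>v x)) = ip E x x / 2"
    using x mult_mat_vec_carrier[OF carr(1) x] by (simp add: ip_def)
  also have "ip E x x = (x $ (m - 1))\<^sup>2 - (x $ 0)\<^sup>2"
    unfolding E_def ip_mat_diag[OF x x] using m
    by (simp add: left_diff_distrib sum_subtractf if_distrib[of "\<lambda>t. t * _"] sum.delta power2_eq_square cong: if_cong)
  finally show ?thesis by simp
qed


text \<open>With \<open>e = - \<mu> - 1/2 > 0\<close> the claim says that \<open>e * a\<^sup>2 +
  \<mu> * a * b + \<mu>\<^sup>2 / (4 * e) * b\<^sup>2\<close> is nonnegative, and this is a perfect
  square over \<open>4 * e\<close>. The constant in the statement is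
  \<open>\<mu>\<^sup>2 / (4 * e)\<close>.\<close>

lemma quadratic_penalty:
  fixes \<mu> a b :: real
  assumes "\<mu> < -1/2"
  shows "- a\<^sup>2 / 2 - \<mu> * a * (a - b) \<ge> - (\<mu>\<^sup>2 / (- 4 * \<mu> - 2)) * b\<^sup>2"
proof -
  define e where "e = - \<mu> - 1 / 2"
  have e: "e > 0" using assms by (simp add: e_def)
  have "0 \<le> (2 * e * a + \<mu> * b)\<^sup>2 / (4 * e)"
    using e by simp
  also have "\<dots> = e * a\<^sup>2 + \<mu> * a * b + \<mu>\<^sup>2 / (4 * e) * b\<^sup>2"
    using e by (simp add: field_simps power2_eq_square)
  finally show ?thesis
    by (simp add: e_def algebra_simps power2_eq_square)
qed

text \<open>The penalty reaches only the first time level, where the quadrature weight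
  \<open>w 0\<close> cancels the factor \<open>1 / w 0\<close>. Each column thus reduces to
  summation by parts plus a quadratic in its initial value, which \<open>quadratic_penalty\<close>
  bounds by the datum.\<close>

lemma time_penalty_estimate:
  fixes \<mu> :: real
  assumes \<mu>: "\<mu> < -1/2" and m: "0 < m"
    and D: "D \<in> carrier_mat m m" and X: "X \<in> carrier_mat m n" and F: "F \<in> carrier_mat m n"
    and w0: "w 0 \<noteq> 0"
    and sbp: "\<And>x. x \<in> carrier_vec m \<Longrightarrow>
      ((x $ (m - 1))\<^sup>2 - (x $ 0)\<^sup>2) / 2 \<le> (\<Sum>k<m. w k * x $ k * (D *\<^sub>v x) $ k)"
    and Z: "Z = D * X - \<mu> \<cdot>\<^sub>m (mat_diag m (\<lambda>k. if k = 0 then 1 / w 0 else 0) * (X - F))"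
    and i: "i < n"
  shows "(X $$ (m - 1, i))\<^sup>2 / 2 - \<mu>\<^sup>2 / (- 4 * \<mu> - 2) * (F $$ (0, i))\<^sup>2
    \<le> (\<Sum>k<m. w k * X $$ (k, i) * Z $$ (k, i))"
proof -
  let ?a = "X $$ (0, i)" and ?b = "F $$ (0, i)"
  have "Z $$ (k, i) = (D *\<^sub>v col X i) $ k - (if k = 0 then \<mu> / w 0 * (?a - ?b) else 0)" if "k < m" for k
    using that D X F i unfolding Z mat_diag_mult_left[OF minus_carrier_mat[OF F]] by auto
  then have "(\<Sum>k<m. w k * X $$ (k, i) * Z $$ (k, i)) =
      (\<Sum>k<m. w k * col X i $ k * (D *\<^sub>v col X i) $ k - (if k = 0 then \<mu> * ?a * (?a - ?b) else 0))"
    using X i w0 by (intro sum.cong) (auto simp: right_diff_distrib)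
  also have "\<dots> = (\<Sum>k<m. w k * col X i $ k * (D *\<^sub>v col X i) $ k) - \<mu> * ?a * (?a - ?b)"
    using m by (simp add: sum_subtractf sum.delta)
  also have "\<dots> \<ge> ((X $$ (m - 1, i))\<^sup>2 - ?a\<^sup>2) / 2 - \<mu> * ?a * (?a - ?b)"
    using sbp[of "col X i"] X i m by simp
  finally show ?thesis
    using quadratic_penalty[OF \<mu>, where a = ?a and b = ?b] by (simp add: diff_divide_distrib)
qed

text \<open>With \<open>\<mu>\<^sub>2 = \<mu>\<^sub>1\<close> and \<open>\<mu>\<^sub>4 = - \<mu>\<^sub>1 \<mu>\<^sub>3\<close> the second-order scheme, written for the
  \<open>M \<times> N\<close> matrix of \<open>U\<close>, factors into a first-order system in time.\<close>
lemma first_order_form: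
  fixes X :: "real mat"
  assumes carr: "Di \<in> carrier_mat M M" "Dj \<in> carrier_mat M M" "P \<in> carrier_mat M M"
      "X \<in> carrier_mat M N" "F \<in> carrier_mat M N" "G \<in> carrier_mat M N" "R \<in> carrier_mat N N" "L \<in> carrier_mat M N"
    and Y: "Y = Dj * X - \<mu>1 \<cdot>\<^sub>m (P * (X - F))"
    and eq: "Di * Dj * X + Dj * X * R - L = \<mu>1 \<cdot>\<^sub>m (P * (X - F) * R) + \<mu>1 \<cdot>\<^sub>m (Di * P * (X - F))
      + \<mu>3 \<cdot>\<^sub>m (P * (Dj * X - G)) + (- \<mu>1 * \<mu>3) \<cdot>\<^sub>m (P * P * (X - F))"
  shows "Di * Y - \<mu>3 \<cdot>\<^sub>m (P * (Y - G)) = L - Y * R"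
proof -
  have XF: "X - F \<in> carrier_mat M N" and PXF: "P * (X - F) \<in> carrier_mat M N"
    and DjX: "Dj * X \<in> carrier_mat M N"
    using carr by auto
  have Y': "Y \<in> carrier_mat M N" using carr by (auto simp: Y)
  have DiY: "Di * Y = Di * Dj * X - \<mu>1 \<cdot>\<^sub>m (Di * P * (X - F))"
    unfolding Y using carr PXF XF DjX
    by (simp add: mult_minus_distrib_mat[of _ M M _ N] mult_smult_distrib[of _ M M _ N] assoc_mult_mat[of _ M M _ M _ N])
  have YR: "Y * R = Dj * X * R - \<mu>1 \<cdot>\<^sub>m (P * (X - F) * R)"
    unfolding Y using carr PXF XF DjX
    by (simp add: minus_mult_distrib_mat[of _ M N _ _ N] mult_smult_assoc_mat[of _ M N _ N])
  \<comment> \<open>The penalty contained in \<open>Y\<close> is penalised once more by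
    \<open>P\<close>. This yields the term in \<open>P * P\<close>, which the coefficient
    \<open>- \<mu>1 * \<mu>3\<close> in \<open>eq\<close> balances.\<close>
  have "P * (Y - G) = P * ((Dj * X - G) - \<mu>1 \<cdot>\<^sub>m (P * (X - F)))"
    using carr PXF DjX by (intro arg_cong[of _ _ "(*) P"] eq_matI) (auto simp: Y)
  also have "\<dots> = P * (Dj * X - G) - P * (\<mu>1 \<cdot>\<^sub>m (P * (X - F)))"
    using minus_carrier_mat[OF carr(6)] smult_carrier_mat[OF PXF] by (rule mult_minus_distrib_mat[OF carr(3)])
  also have "P * (\<mu>1 \<cdot>\<^sub>m (P * (X - F))) = \<mu>1 \<cdot>\<^sub>m (P * P * (X - F))"
    by (simp only: mult_smult_distrib[OF carr(3) PXF] assoc_mult_mat[OF carr(3,3) XF])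
  finally have PYG: "P * (Y - G) = P * (Dj * X - G) - \<mu>1 \<cdot>\<^sub>m (P * P * (X - F))" .
  show ?thesis
  proof (rule eq_matI)
    fix k i assume "k < dim_row (L - Y * R)" "i < dim_col (L - Y * R)"
    then have ki: "k < M" "i < N" using carr Y' by auto
    \<comment> \<open>Naming the six products keeps them opaque to the simplifier, so that only a
      scalar identity in their entries remains.\<close>
    define a1 where "a1 = Di * Dj * X" define a2 where "a2 = Dj * X * R"
    define a3 where "a3 = P * (X - F) * R" define a4 where "a4 = Di * P * (X - F)"
    define a5 where "a5 = P * (Dj * X - G)" define a6 where "a6 = P * P * (X - F)"
    have dims: "a1 \<in> carrier_mat M N" "a2 \<in> carrier_mat M N" "a3 \<in> carrier_mat M N"
        "a4 \<in> carrier_mat M N" "a5 \<in> carrier_mat M N" "a6 \<in> carrier_mat M N"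
      using carr by (auto simp: a1_def a2_def a3_def a4_def a5_def a6_def)
    have "(a1 + a2 - L) $$ (k, i) = (\<mu>1 \<cdot>\<^sub>m a3 + \<mu>1 \<cdot>\<^sub>m a4 + \<mu>3 \<cdot>\<^sub>m a5 + (- \<mu>1 * \<mu>3) \<cdot>\<^sub>m a6) $$ (k, i)"
      using eq by (simp add: a1_def a2_def a3_def a4_def a5_def a6_def)
    then show "(Di * Y - \<mu>3 \<cdot>\<^sub>m (P * (Y - G))) $$ (k, i) = (L - Y * R) $$ (k, i)"
      unfolding DiY YR PYG a1_def[symmetric] a2_def[symmetric] a3_def[symmetric] a4_def[symmetric]
        a5_def[symmetric] a6_def[symmetric]
      using dims carr(8) ki by (simp add: algebra_simps)
  qed (use carr Y' in auto)
qed

section \<open>Energy balance of the space operators\<close>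

text \<open>The weight \<open>w i / (c i)\<^sup>2\<close> cancels the factors
  \<open>c\<^sup>2\<close> and inverse norm in both \<open>D_xx\<close> and \<open>B_mat\<close>.
  What is left of \<open>D_xx\<close> is minus \<open>D\<^sup>T * Hx * D\<close>, whose left factor
  moves onto \<open>v\<close>; what is left of \<open>B_mat\<close> is the boundary form
  \<open>BT\<close>.\<close>

lemma space_energy_identity:
  fixes w c s :: "nat \<Rightarrow> real"
  assumes N: "0 < N" and D: "D \<in> carrier_mat N N" and u: "u \<in> carrier_vec N" and v: "v \<in> carrier_vec N"
    and w: "\<And>i. i < N \<Longrightarrow> w i > 0" and c: "\<And>i. i < N \<Longrightarrow> c i \<noteq> 0"
  defines "Hx \<equiv> mat_diag N w" and "cm \<equiv> mat_diag N c" and "sm \<equiv> mat_diag N s"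
  shows "(\<Sum>i<N. w i / (c i)\<^sup>2 * v $ i *
      (((cm ^\<^sub>m 2 * D_xx Hx D) *\<^sub>v u) $ i - ((sm ^\<^sub>m 2 + B_mat N Hx cm \<alpha>L \<beta>L \<alpha>R \<beta>R) *\<^sub>v v) $ i))
    = - ip Hx (D *\<^sub>v v) (D *\<^sub>v u) - sqnorm Hx (mat_inv cm *\<^sub>v (sm *\<^sub>v v)) - BT N \<alpha>L \<beta>L \<alpha>R \<beta>R v"
proof -
  have w_nz: "w i \<noteq> 0" if "i < N" for i
    using w[OF that] by simp
  have Hinv: "mat_inv Hx = mat_diag N (\<lambda>i. 1 / w i)"
    unfolding Hx_def by (rule mat_inv_mat_diag) (use w in force)
  have cinv: "mat_inv cm = mat_diag N (\<lambda>i. 1 / c i)"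
    unfolding cm_def by (rule mat_inv_mat_diag) (use c in force)
  have Hx: "Hx \<in> carrier_mat N N" by (simp add: Hx_def)
  define z where "z = D\<^sup>T *\<^sub>v (Hx *\<^sub>v (D *\<^sub>v u))"
  have z: "z \<in> carrier_vec N" unfolding z_def by (rule carrier_vecI) (use D in simp)
  have DT: "D\<^sup>T \<in> carrier_mat N N" and Du: "D *\<^sub>v u \<in> carrier_vec N" and Dv: "D *\<^sub>v v \<in> carrier_vec N"
    using D u v by auto
  define S where "S = mat_diag N (\<lambda>i. (c i)\<^sup>2)"
  define J where "J = mat_diag N (\<lambda>i. 1 / w i)"
  have SJ: "S \<in> carrier_mat N N" "J \<in> carrier_mat N N" by (auto simp: S_def J_def)
  have Dxx: "(cm ^\<^sub>m 2 * D_xx Hx D) *\<^sub>v u = - (S *\<^sub>v (J *\<^sub>v z))"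
  proof -
    have "(cm ^\<^sub>m 2 * D_xx Hx D) *\<^sub>v u = S *\<^sub>v (- (J * D\<^sup>T * Hx * D) *\<^sub>v u)"
      unfolding D_xx_def Hinv cm_def mat_diag_sq S_def[symmetric] J_def[symmetric]
      by (rule assoc_mult_mat_vec[of _ N N]) (use SJ D Hx u in auto)
    also have "- (J * D\<^sup>T * Hx * D) *\<^sub>v u = - ((J * D\<^sup>T * Hx * D) *\<^sub>v u)"
      by (rule uminus_mult_mat_vec) (use u D in auto)
    also have "(J * D\<^sup>T * Hx * D) *\<^sub>v u = J *\<^sub>v z"
      using SJ D DT Hx u Du by (simp add: z_def assoc_mult_mat_vec[of _ N N _ N])
    also have "S *\<^sub>v (- (J *\<^sub>v z)) = - (S *\<^sub>v (J *\<^sub>v z))"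
      by (rule eq_vecI) (use SJ z in auto)
    finally show ?thesis .
  qed
  \<comment> \<open>The diagonal of the boundary matrix; for \<open>N = 1\<close> both contributions
    fall on the same entry and are combined.\<close>
  define r where "r i = \<beta>R / \<alpha>R * (if i = N - 1 then 1 else 0) - \<beta>L / \<alpha>L * (if i = 0 then 1 else 0)" for i
  have "(\<beta>R / \<alpha>R) \<cdot>\<^sub>m proj N (N - 1) - (\<beta>L / \<alpha>L) \<cdot>\<^sub>m proj N 0 = mat_diag N r"
    using N by (intro eq_matI) (auto simp: proj_eq_mat_diag r_def)
  then have "sm ^\<^sub>m 2 + B_mat N Hx cm \<alpha>L \<beta>L \<alpha>R \<beta>R = mat_diag N (\<lambda>i. (s i)\<^sup>2 + 1 / w i * (c i)\<^sup>2 * r i)"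
    unfolding B_mat_def Hinv sm_def cm_def mat_diag_sq by (intro eq_matI) auto
  then have "(\<Sum>i<N. w i / (c i)\<^sup>2 * v $ i *
      (((cm ^\<^sub>m 2 * D_xx Hx D) *\<^sub>v u) $ i - ((sm ^\<^sub>m 2 + B_mat N Hx cm \<alpha>L \<beta>L \<alpha>R \<beta>R) *\<^sub>v v) $ i))
    = (\<Sum>i<N. - (v $ i * z $ i) - w i * (s i / c i * v $ i)\<^sup>2 - r i * (v $ i)\<^sup>2)"
    using w_nz c z v unfolding Dxx S_def J_def
    by (intro sum.cong) (auto simp: mat_diag_mult_vec field_simps power2_eq_square)
  also have "\<dots> = - (v \<bullet> z) - (\<Sum>i<N. w i * (s i / c i * v $ i)\<^sup>2) - (\<Sum>i<N. r i * (v $ i)\<^sup>2)"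
    using z by (simp add: sum_subtractf sum_negf scalar_prod_def lessThan_atLeast0)
  also have "v \<bullet> z = ip Hx (D *\<^sub>v v) (D *\<^sub>v u)"
    using transpose_vec_mult_scalar[OF D v, of "Hx *\<^sub>v (D *\<^sub>v u)"] Hx Du z v Dv
    by (simp add: z_def ip_def comm_scalar_prod[of v N] comm_scalar_prod[of "D *\<^sub>v v" N])
  also have "(\<Sum>i<N. w i * (s i / c i * v $ i)\<^sup>2) = sqnorm Hx (mat_inv cm *\<^sub>v (sm *\<^sub>v v))"
    using v by (simp add: cinv sm_def Hx_def mat_diag_mult_vec sqnorm_mat_diag)
  also have "(\<Sum>i<N. r i * (v $ i)\<^sup>2) = BT N \<alpha>L \<beta>L \<alpha>R \<beta>R v"
  proof -
    have "(\<Sum>i<N. r i * (v $ i)\<^sup>2) = (\<Sum>i<N. (if i = N - 1 then \<beta>R / \<alpha>R * (v $ (N - 1))\<^sup>2 else 0)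
        - (if i = 0 then \<beta>L / \<alpha>L * (v $ 0)\<^sup>2 else 0))"
      by (intro sum.cong) (auto simp: r_def left_diff_distrib)
    then show ?thesis
      using N by (simp add: sum_subtractf sum.delta BT_def)
  qed
  finally show ?thesis .
qed


section \<open>Combination of the time and space estimates\<close>

text \<open>Passes from the matrix form back to a space operator acting on one time level.\<close>

lemma index_mult_transpose:
  fixes X :: "'a :: comm_semiring_0 mat"
  assumes "X \<in> carrier_mat m n" "A \<in> carrier_mat n' n" "k < m" "i < n'"
  shows "(X * A\<^sup>T) $$ (k, i) = (A *\<^sub>v row X k) $ i"
  using assms by (simp add: comm_scalar_prod[of "row X k" n])

text \<open>The column estimate is applied to the space differences of \<open>X\<close> and to
  \<open>Y\<close> itself, multiplied by the nonnegative weights \<open>w i\<close> and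
  \<open>w i / (c i)\<^sup>2\<close>, and summed over space. The data \<open>F\<close> and
  \<open>G\<close> enter through their first rows, the only ones that \<open>P\<close> sees.\<close>

lemma energy_estimate:
  fixes w c s \<tau> :: "nat \<Rightarrow> real" and X Y :: "real mat"
  assumes \<mu>: "\<mu>1 < -1/2" "\<mu>3 < -1/2"
    and N: "0 < N" and M: "0 < M"
    and D: "D \<in> carrier_mat N N" and Di: "Di \<in> carrier_mat M M" and Dj: "Dj \<in> carrier_mat M M"
    and w: "\<And>i. i < N \<Longrightarrow> w i > 0" and \<tau>: "\<And>k. k < M \<Longrightarrow> \<tau> k > 0"
    and c: "\<And>i. i < N \<Longrightarrow> c i \<noteq> 0"
    and sbp: "\<And>x E. x \<in> carrier_vec M \<Longrightarrow> E \<in> {Di, Dj} \<Longrightarrow>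
      ((x $ (M - 1))\<^sup>2 - (x $ 0)\<^sup>2) / 2 \<le> (\<Sum>k<M. \<tau> k * x $ k * (E *\<^sub>v x) $ k)"
    and f: "f \<in> carrier_vec N" and g: "g \<in> carrier_vec N"
    and X: "X \<in> carrier_mat M N" and F: "F \<in> carrier_mat M N" "row F 0 = f" and G: "G \<in> carrier_mat M N" "row G 0 = g"
    and P: "P = mat_diag M (\<lambda>k. if k = 0 then 1 / \<tau> 0 else 0)"
    and Hx: "Hx = mat_diag N w" and cm: "cm = mat_diag N c" and sm: "sm = mat_diag N s"
    and R: "R = sm ^\<^sub>m 2 + B_mat N Hx cm \<alpha>L \<beta>L \<alpha>R \<beta>R"
    and Y: "Y = Dj * X - \<mu>1 \<cdot>\<^sub>m (P * (X - F))"
    and eq: "Di * Y - \<mu>3 \<cdot>\<^sub>m (P * (Y - G)) = X * (cm ^\<^sub>m 2 * D_xx Hx D)\<^sup>T - Y * R\<^sup>T"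
  shows "energy Hx cm D (row X (M - 1)) (row Y (M - 1))
    + (\<Sum>k<M. \<tau> k * (sqnorm Hx (mat_inv cm *\<^sub>v (sm *\<^sub>v row Y k)) + BT N \<alpha>L \<beta>L \<alpha>R \<beta>R (row Y k)))
    \<le> 2 * (\<mu>1\<^sup>2 / (- 4 * \<mu>1 - 2) + \<mu>3\<^sup>2 / (- 4 * \<mu>3 - 2)) * energy Hx cm D f g"
proof -
  define K1 where "K1 = \<mu>1\<^sup>2 / (- 4 * \<mu>1 - 2)"
  define K3 where "K3 = \<mu>3\<^sup>2 / (- 4 * \<mu>3 - 2)"
  define diss where "diss k = sqnorm Hx (mat_inv cm *\<^sub>v (sm *\<^sub>v row Y k)) + BT N \<alpha>L \<beta>L \<alpha>R \<beta>R (row Y k)" for k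
  define Z where "Z = X * (cm ^\<^sub>m 2 * D_xx Hx D)\<^sup>T - Y * R\<^sup>T"
  have K: "K1 \<ge> 0" "K3 \<ge> 0" using \<mu> by (auto simp: K1_def K3_def)
  have Hinv: "mat_inv Hx = mat_diag N (\<lambda>i. 1 / w i)"
    unfolding Hx by (rule mat_inv_mat_diag) (use w in force)
  have cinv: "mat_inv cm = mat_diag N (\<lambda>i. 1 / c i)"
    unfolding cm by (rule mat_inv_mat_diag) (use c in force)
  have Pc: "P \<in> carrier_mat M M" by (simp add: P)
  have Yc: "Y \<in> carrier_mat M N" using Dj X F Pc by (auto simp: Y)
  have DT: "D\<^sup>T \<in> carrier_mat N N" using D by simp
  have A: "cm ^\<^sub>m 2 * D_xx Hx D \<in> carrier_mat N N"
    unfolding D_xx_def Hinv cm mat_diag_sq using D by (auto simp: Hx intro!: mult_carrier_mat[OF mat_diag_dim])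
  have Rc: "R \<in> carrier_mat N N"
    unfolding R B_mat_def Hinv sm cm mat_diag_sq
    by (rule carrier_matI) (use N in \<open>simp_all add: proj_eq_mat_diag\<close>)

  \<comment> \<open>Right multiplication by \<open>D\<^sup>T\<close> commutes with time operators on
    the left, so \<open>YD\<close> is the penalised time derivative of \<open>XD\<close> with datum
    \<open>FD\<close>.\<close>
  define XD where "XD = X * D\<^sup>T"
  define YD where "YD = Y * D\<^sup>T"
  define FD where "FD = F * D\<^sup>T"
  have XDc: "XD \<in> carrier_mat M N" "FD \<in> carrier_mat M N" using X F DT by (auto simp: XD_def FD_def)
  have YD: "YD = Dj * XD - \<mu>1 \<cdot>\<^sub>m (P * (XD - FD))"
  proof -
    have XF: "X - F \<in> carrier_mat M N" using F(1) by (rule minus_carrier_mat)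
    have PXF: "P * (X - F) \<in> carrier_mat M N" using Pc XF by (rule mult_carrier_mat)
    have DjX: "Dj * X \<in> carrier_mat M N" using Dj X by (rule mult_carrier_mat)
    have "YD = Dj * X * D\<^sup>T - \<mu>1 \<cdot>\<^sub>m (P * (X - F)) * D\<^sup>T"
      unfolding YD_def Y by (rule minus_mult_distrib_mat[OF DjX smult_carrier_mat[OF PXF] DT])
    also have "\<mu>1 \<cdot>\<^sub>m (P * (X - F)) * D\<^sup>T = \<mu>1 \<cdot>\<^sub>m (P * (X - F) * D\<^sup>T)"
      by (rule mult_smult_assoc_mat[OF PXF DT])
    also have "P * (X - F) * D\<^sup>T = P * ((X - F) * D\<^sup>T)"
      by (rule assoc_mult_mat[OF Pc XF DT])
    also have "(X - F) * D\<^sup>T = XD - FD"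
      unfolding XD_def FD_def by (rule minus_mult_distrib_mat[OF X F(1) DT])
    also have "Dj * X * D\<^sup>T = Dj * XD"
      unfolding XD_def by (rule assoc_mult_mat[OF Dj X DT])
    finally show ?thesis .
  qed
  have XDr: "XD $$ (k, i) = (D *\<^sub>v row X k) $ i" "YD $$ (k, i) = (D *\<^sub>v row Y k) $ i"
      "FD $$ (k, i) = (D *\<^sub>v row F k) $ i" if "k < M" "i < N" for k i
    unfolding XD_def YD_def FD_def
    by (rule index_mult_transpose[OF X D that] index_mult_transpose[OF Yc D that] index_mult_transpose[OF F(1) D that])+
  have rows: "row X k \<in> carrier_vec N" "row Y k \<in> carrier_vec N" if "k < M" for k
    using that X Yc by (auto intro: row_carrier_vec)
  have Drows: "D *\<^sub>v row X k \<in> carrier_vec N" "D *\<^sub>v row Y k \<in> carrier_vec N" for k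
    using D by (auto intro: carrier_vecI)

  have "sqnorm Hx (D *\<^sub>v row X (M - 1)) / 2 - K1 * sqnorm Hx (D *\<^sub>v f)
      = (\<Sum>i<N. w i * ((XD $$ (M - 1, i))\<^sup>2 / 2 - K1 * (FD $$ (0, i))\<^sup>2))"
  proof -
    have "D *\<^sub>v f \<in> carrier_vec N" using D f by auto
    then show ?thesis
      using M Drows by (simp add: Hx sqnorm_mat_diag XDr F(2) right_diff_distrib sum_subtractf
          sum_divide_distrib sum_distrib_left mult.left_commute)
  qed
  also have "\<dots> \<le> (\<Sum>i<N. w i * (\<Sum>k<M. \<tau> k * XD $$ (k, i) * YD $$ (k, i)))"
    unfolding K1_def
    by (intro sum_mono mult_left_mono time_penalty_estimate[OF \<mu>(1) M Dj XDc])
      (use w \<tau>[of 0] M sbp YD in \<open>auto simp: P less_imp_le\<close>)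
  \<comment> \<open>Exchanging the sums turns the inner one into the space inner product at a fixed
    time level.\<close>
  also have "\<dots> = (\<Sum>k<M. \<tau> k * ip Hx (D *\<^sub>v row Y k) (D *\<^sub>v row X k))"
    using Drows by (simp add: sum_distrib_left sum.swap[of _ "{..<M}"] Hx ip_mat_diag XDr mult_ac)
  finally have est1: "sqnorm Hx (D *\<^sub>v row X (M - 1)) / 2 - K1 * sqnorm Hx (D *\<^sub>v f)
      \<le> (\<Sum>k<M. \<tau> k * ip Hx (D *\<^sub>v row Y k) (D *\<^sub>v row X k))" .

  have sqc: "sqnorm Hx (mat_inv cm *\<^sub>v v) = (\<Sum>i<N. w i / (c i)\<^sup>2 * (v $ i)\<^sup>2)" if "v \<in> carrier_vec N" for v
    using that by (simp add: cinv Hx mat_diag_mult_vec sqnorm_mat_diag power_divide)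
  have "sqnorm Hx (mat_inv cm *\<^sub>v row Y (M - 1)) / 2 - K3 * sqnorm Hx (mat_inv cm *\<^sub>v g)
      = (\<Sum>i<N. w i / (c i)\<^sup>2 * ((Y $$ (M - 1, i))\<^sup>2 / 2 - K3 * (G $$ (0, i))\<^sup>2))"
    using M Yc g G rows[of "M - 1"] by (auto simp: sqc right_diff_distrib sum_subtractf
          sum_divide_distrib sum_distrib_left mult.left_commute)
  \<comment> \<open>By \<open>eq\<close>, \<open>Z\<close> is the penalised time derivative of
    \<open>Y\<close> with datum \<open>G\<close>.\<close>
  also have "\<dots> \<le> (\<Sum>i<N. w i / (c i)\<^sup>2 * (\<Sum>k<M. \<tau> k * Y $$ (k, i) * Z $$ (k, i)))"
    unfolding K3_def
    by (intro sum_mono mult_left_mono time_penalty_estimate[OF \<mu>(2) M Di Yc G(1)])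
      (use w \<tau>[of 0] M sbp eq in \<open>auto simp: P Z_def less_imp_le\<close>)
  also have "\<dots> = (\<Sum>k<M. \<tau> k * (\<Sum>i<N. w i / (c i)\<^sup>2 * row Y k $ i *
      (((cm ^\<^sub>m 2 * D_xx Hx D) *\<^sub>v row X k) $ i - (R *\<^sub>v row Y k) $ i)))"
  proof -
    have "Z $$ (k, i) = ((cm ^\<^sub>m 2 * D_xx Hx D) *\<^sub>v row X k) $ i - (R *\<^sub>v row Y k) $ i" if "k < M" "i < N" for k i
      using index_mult_transpose[OF X A that] index_mult_transpose[OF Yc Rc that] that X Yc A Rc
      by (simp add: Z_def del: index_mult_mat_vec index_mult_mat(1))
    then show ?thesis
      using Yc by (simp add: sum_distrib_left sum.swap[of _ "{..<M}"] mult_ac)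
  qed
  also have "\<dots> = (\<Sum>k<M. \<tau> k * (- ip Hx (D *\<^sub>v row Y k) (D *\<^sub>v row X k) - diss k))"
    unfolding R Hx cm sm diss_def
    by (intro sum.cong refl arg_cong2[of _ _ _ _ "(*)"] trans[OF space_energy_identity])
      (use N D rows w c in auto)
  also have "\<dots> = - (\<Sum>k<M. \<tau> k * ip Hx (D *\<^sub>v row Y k) (D *\<^sub>v row X k)) - (\<Sum>k<M. \<tau> k * diss k)"
    by (simp add: right_diff_distrib sum_subtractf sum_negf)
  \<comment> \<open>The coupling sum bounds \<open>est1\<close> from above and appears here with a
    minus sign, so adding the two estimates removes it.\<close>
  finally have "energy Hx cm D (row X (M - 1)) (row Y (M - 1)) + (\<Sum>k<M. \<tau> k * diss k)
      \<le> K1 * sqnorm Hx (D *\<^sub>v f) + K3 * sqnorm Hx (mat_inv cm *\<^sub>v g)"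
    using est1 by (simp add: energy_def add_divide_distrib)
  also have "\<dots> \<le> (K1 + K3) * (sqnorm Hx (D *\<^sub>v f) + sqnorm Hx (mat_inv cm *\<^sub>v g))"
  proof -
    have "sqnorm Hx v \<ge> 0" if "v \<in> carrier_vec N" for v
      unfolding Hx sqnorm_mat_diag[OF that] by (intro sum_nonneg mult_nonneg_nonneg) (use w in \<open>auto simp: less_imp_le\<close>)
    moreover have "D *\<^sub>v f \<in> carrier_vec N" "mat_inv cm *\<^sub>v g \<in> carrier_vec N"
      using D by (auto simp: cinv intro!: carrier_vecI)
    ultimately have "sqnorm Hx (D *\<^sub>v f) \<ge> 0" "sqnorm Hx (mat_inv cm *\<^sub>v g) \<ge> 0"
      by blast+
    then show ?thesis using K by (simp add: algebra_simps)
  qed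
  \<comment> \<open>The factor 2 compensates the half in \<open>energy\<close>.\<close>
  also have "\<dots> = 2 * (K1 + K3) * energy Hx cm D f g"
    by (simp add: energy_def algebra_simps)
  finally show ?thesis by (simp only: K1_def K3_def diss_def)
qed

section \<open>Transfer of the energy estimate to the fully discrete scheme\<close>

text \<open>The witness for \<open>C\<close> is twice the sum of the two constants from completing
  the square, a function of \<open>\<mu>1\<close> and \<open>\<mu>3\<close> alone. Choosing it
  before the domain, coefficients, operators, grid sizes and data expresses its independence of the
  grid.\<close>

theorem theorem9:
  fixes \<mu>1 \<mu>2 \<mu>3 \<mu>4 :: real
  assumes "\<mu>1 < -1/2" and "\<mu>3 < -1/2" and "\<mu>2 = \<mu>1" and "\<mu>4 = - \<mu>1 * \<mu>3"
  shows "\<exists>C>0.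
    \<forall>(xL::real) (xR::real) (T::real)
      (c::real \<Rightarrow> real) (\<sigma>::real \<Rightarrow> real) (s::real \<Rightarrow> real \<Rightarrow> real)
      (\<alpha>L::real) (\<beta>L::real) (\<alpha>R::real) (\<beta>R::real)
      (p::nat) (N0::nat) (Dm::nat \<Rightarrow> real mat) (Dp::nat \<Rightarrow> real mat) (hx::nat \<Rightarrow> nat \<Rightarrow> real)
      (q::nat) (M0::nat) (Dt::nat \<Rightarrow> nat \<Rightarrow> real mat) (ht::nat \<Rightarrow> nat \<Rightarrow> real)
      (i::nat) (j::nat) (N::nat) (M::nat)
      (f::real vec) (g::real vec) (U::real vec) (V::real vec).
      xL < xR \<longrightarrow> 0 < T \<longrightarrow>
      (\<forall>x\<in>{xL..xR}. c x \<noteq> 0) \<longrightarrow>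
      \<alpha>L \<noteq> 0 \<longrightarrow> \<alpha>R \<noteq> 0 \<longrightarrow> \<alpha>L * \<beta>L \<le> 0 \<longrightarrow> \<alpha>R * \<beta>R \<ge> 0 \<longrightarrow>
      2 \<le> N0 \<longrightarrow> dp_sbp xL xR p N0 Dm Dp hx \<longrightarrow>
      2 \<le> M0 \<longrightarrow> time_sbp T q M0 Dt ht \<longrightarrow>
      i \<in> {1, 2} \<longrightarrow> j \<in> {1, 2} \<longrightarrow> N0 \<le> N \<longrightarrow> M0 \<le> M \<longrightarrow>
      f \<in> carrier_vec N \<longrightarrow> g \<in> carrier_vec N \<longrightarrow>
      U \<in> carrier_vec (M * N) \<longrightarrow> V \<in> carrier_vec (M * N) \<longrightarrow>
      (let Hx = norm_mat xL xR hx N; Ht = norm_mat 0 T ht M;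
           cm = grid_diag xL xR N c; \<sigma>m = grid_diag xL xR N \<sigma>;
           R = (\<sigma>m ^\<^sub>m 2) + B_mat N Hx cm \<alpha>L \<beta>L \<alpha>R \<beta>R;
           F = lift_init M N f; G = lift_init M N g;
           Sbar = source_vec xL xR T s M N
       in
        fully_discrete M N \<mu>1 \<mu>2 \<mu>3 \<mu>4 Ht (Dt i M) (Dt j M) R cm (D_xx Hx (Dm N)) F G Sbar U \<longrightarrow>
        V = aux_field M N \<mu>1 Ht (Dt j M) F U \<longrightarrow>
        (\<forall>k<M. block N k Sbar = 0\<^sub>v N) \<longrightarrow>
        (\<forall>k<M. ht M k > 0 \<and> BT N \<alpha>L \<beta>L \<alpha>R \<beta>R (block N k V) \<ge> 0) \<and>
        energy Hx cm (Dm N) (block N (M - 1) U) (block N (M - 1) V)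
          + (\<Sum>k<M. ht M k *
               (sqnorm Hx (mat_inv cm *\<^sub>v (\<sigma>m *\<^sub>v block N k V))
                + BT N \<alpha>L \<beta>L \<alpha>R \<beta>R (block N k V)) * grid_step 0 T M)
        \<le> C * energy Hx cm (Dm N) f g)"
proof (intro exI[of _ "2 * (\<mu>1\<^sup>2 / (- 4 * \<mu>1 - 2) + \<mu>3\<^sup>2 / (- 4 * \<mu>3 - 2))"] conjI allI impI)
  show "0 < 2 * (\<mu>1\<^sup>2 / (- 4 * \<mu>1 - 2) + \<mu>3\<^sup>2 / (- 4 * \<mu>3 - 2))"
    using assms(1,2) by (intro mult_pos_pos add_pos_pos divide_pos_pos) auto
next
  fix xL xR T :: real and c \<sigma> :: "real \<Rightarrow> real" and s :: "real \<Rightarrow> real \<Rightarrow> real"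
    and \<alpha>L \<beta>L \<alpha>R \<beta>R :: real
    and p N0 :: nat and Dm Dp :: "nat \<Rightarrow> real mat" and hx :: "nat \<Rightarrow> nat \<Rightarrow> real"
    and q M0 :: nat and Dt :: "nat \<Rightarrow> nat \<Rightarrow> real mat" and ht :: "nat \<Rightarrow> nat \<Rightarrow> real"
    and i j N M :: nat and f g U V :: "real vec"
  assume x: "xL < xR" and T: "0 < T" and c: "\<forall>x\<in>{xL..xR}. c x \<noteq> 0"
    and \<alpha>\<beta>: "\<alpha>L \<noteq> 0" "\<alpha>R \<noteq> 0" "\<alpha>L * \<beta>L \<le> 0" "\<alpha>R * \<beta>R \<ge> 0"
    and N0: "2 \<le> N0" and space: "dp_sbp xL xR p N0 Dm Dp hx"
    and M0: "2 \<le> M0" and time: "time_sbp T q M0 Dt ht"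
    and i: "i \<in> {1, 2}" and j: "j \<in> {1, 2}" and NN0: "N0 \<le> N" and MM0: "M0 \<le> M"
    and f: "f \<in> carrier_vec N" and g: "g \<in> carrier_vec N"
    and U: "U \<in> carrier_vec (M * N)" and V: "V \<in> carrier_vec (M * N)"
  define Hx where "Hx = norm_mat xL xR hx N"
  define Ht where "Ht = norm_mat 0 T ht M"
  define cm where "cm = grid_diag xL xR N c"
  define \<sigma>m where "\<sigma>m = grid_diag xL xR N \<sigma>"
  define R where "R = (\<sigma>m ^\<^sub>m 2) + B_mat N Hx cm \<alpha>L \<beta>L \<alpha>R \<beta>R"
  define F where "F = lift_init M N f"
  define G where "G = lift_init M N g"
  define Sbar where "Sbar = source_vec xL xR T s M N"
  define Dxx where "Dxx = D_xx Hx (Dm N)"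
  define Di where "Di = Dt i M"
  define Dj where "Dj = Dt j M"
  define w where "w = (\<lambda>k. hx N k * grid_step xL xR N)"
  define \<tau> where "\<tau> = (\<lambda>k. ht M k * grid_step 0 T M)"
  define cc where "cc = (\<lambda>k. c (grid_pt xL xR N k))"
  define P where "P = mat_diag M (\<lambda>k. if k = 0 then 1 / \<tau> 0 else 0)"
  have N: "2 \<le> N" and M: "2 \<le> M" using N0 NN0 M0 MM0 by auto
  have Hx': "Hx = mat_diag N w" and Ht': "Ht = mat_diag M \<tau>"
    and cm': "cm = mat_diag N cc" and \<sigma>m': "\<sigma>m = mat_diag N (\<lambda>k. \<sigma> (grid_pt xL xR N k))"
    by (simp_all add: Hx_def Ht_def cm_def \<sigma>m_def norm_mat_def grid_diag_def w_def \<tau>_def cc_def)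
  have w: "w k > 0" if "k < N" for k
    using space NN0 that pos_def_mat_diagD[of N w k]
    by (auto simp: dp_sbp_def quadrature_norm_def norm_mat_def w_def)
  have \<tau>: "\<tau> k > 0" if "k < M" for k
    using time MM0 that pos_def_mat_diagD[of M \<tau> k]
    by (auto simp: time_sbp_def quadrature_norm_def norm_mat_def \<tau>_def)
  have step: "grid_step 0 T M > 0"
    using T M by (simp add: grid_step_def)
  have ht: "ht M k > 0" if "k < M" for k
    using \<tau>[OF that] step by (simp add: \<tau>_def zero_less_mult_iff)
  have cc: "cc k \<noteq> 0" if "k < N" for k
  proof -
    \<comment> \<open>The coefficient is known to be nonzero on the closed interval, so the grid
      point must lie there; indices start at 0, hence \<open>k\<close> is at most
      \<open>N - 1\<close>.\<close>
    have "real k * ((xR - xL) / (real N - 1)) \<le> (real N - 1) * ((xR - xL) / (real N - 1))"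
      using that x N by (intro mult_right_mono) auto
    then have "grid_pt xL xR N k \<in> {xL..xR}"
      using that x N by (auto simp: grid_pt_def grid_step_def)
    then show ?thesis using c by (simp add: cc_def)
  qed
  have D: "Dm N \<in> carrier_mat N N"
    using space NN0 by (auto simp: dp_sbp_def Let_def)
  have Dij: "Di \<in> carrier_mat M M" "Dj \<in> carrier_mat M M"
    using time i j MM0 by (auto simp: time_sbp_def Di_def Dj_def)
  have sbp: "((x $ (M - 1))\<^sup>2 - (x $ 0)\<^sup>2) / 2 \<le> (\<Sum>k<M. \<tau> k * x $ k * (E *\<^sub>v x) $ k)"
    if "x \<in> carrier_vec M" "E \<in> {Di, Dj}" for x E
  proof (rule time_S_nonneg_imp_sbp)
    have "\<exists>l\<in>{1, 2}. E = Dt l M" using that i j by (auto simp: Di_def Dj_def)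
    then show "0 \<le> x \<bullet> (time_S (mat_diag M \<tau>) E M *\<^sub>v x)"
      using time MM0 that(1) Ht' unfolding time_sbp_def Ht_def by metis
  qed (use M that Dij in auto)

  show "let Hx = norm_mat xL xR hx N; Ht = norm_mat 0 T ht M;
           cm = grid_diag xL xR N c; \<sigma>m = grid_diag xL xR N \<sigma>;
           R = (\<sigma>m ^\<^sub>m 2) + B_mat N Hx cm \<alpha>L \<beta>L \<alpha>R \<beta>R;
           F = lift_init M N f; G = lift_init M N g;
           Sbar = source_vec xL xR T s M N
       in
        fully_discrete M N \<mu>1 \<mu>2 \<mu>3 \<mu>4 Ht (Dt i M) (Dt j M) R cm (D_xx Hx (Dm N)) F G Sbar U \<longrightarrow>
        V = aux_field M N \<mu>1 Ht (Dt j M) F U \<longrightarrow>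
        (\<forall>k<M. block N k Sbar = 0\<^sub>v N) \<longrightarrow>
        (\<forall>k<M. ht M k > 0 \<and> BT N \<alpha>L \<beta>L \<alpha>R \<beta>R (block N k V) \<ge> 0) \<and>
        energy Hx cm (Dm N) (block N (M - 1) U) (block N (M - 1) V)
          + (\<Sum>k<M. ht M k *
               (sqnorm Hx (mat_inv cm *\<^sub>v (\<sigma>m *\<^sub>v block N k V))
                + BT N \<alpha>L \<beta>L \<alpha>R \<beta>R (block N k V)) * grid_step 0 T M)
        \<le> 2 * (\<mu>1\<^sup>2 / (- 4 * \<mu>1 - 2) + \<mu>3\<^sup>2 / (- 4 * \<mu>3 - 2)) * energy Hx cm (Dm N) f g"
    unfolding Let_def Hx_def[symmetric] Ht_def[symmetric] cm_def[symmetric] \<sigma>m_def[symmetric]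
    unfolding R_def[symmetric] F_def[symmetric] G_def[symmetric] Sbar_def[symmetric]
      Di_def[symmetric] Dj_def[symmetric] Dxx_def[symmetric]
  proof (intro impI conjI allI)
    fix k assume "k < M" then show "ht M k > 0" by (rule ht)
  next
    fix k
    \<comment> \<open>A quotient has the sign of the corresponding product, which the boundary
      assumptions control.\<close>
    have "\<beta>R / \<alpha>R \<ge> 0" "\<beta>L / \<alpha>L \<le> 0"
      using \<alpha>\<beta> by (auto simp: zero_le_mult_iff zero_le_divide_iff mult_le_0_iff divide_le_0_iff)
    then have "\<beta>R / \<alpha>R * (block N k V $ (N - 1))\<^sup>2 \<ge> 0" "\<beta>L / \<alpha>L * (block N k V $ 0)\<^sup>2 \<le> 0"
      by (simp_all only: mult_nonneg_nonneg mult_nonpos_nonneg zero_le_power2)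
    then show "BT N \<alpha>L \<beta>L \<alpha>R \<beta>R (block N k V) \<ge> 0"
      unfolding BT_def by linarith
  next
    assume scheme: "fully_discrete M N \<mu>1 \<mu>2 \<mu>3 \<mu>4 Ht Di Dj R cm Dxx F G Sbar U"
      and VU: "V = aux_field M N \<mu>1 Ht Dj F U" and S: "\<forall>k<M. block N k Sbar = 0\<^sub>v N"
    have MN0: "0 < M" "0 < N" using M N by auto
    \<comment> \<open>The penalty matrix has the single nonzero entry \<open>1 / \<tau> 0\<close>,
      the form required by \<open>time_penalty_estimate\<close>.\<close>
    have PHt: "mat_inv Ht * proj M 0 = P"
    proof -
      have "mat_inv Ht = mat_diag M (\<lambda>k. 1 / \<tau> k)"
        unfolding Ht' by (rule mat_inv_mat_diag) (use \<tau> in force)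
      then show ?thesis
        using M by (auto simp: proj_eq_mat_diag P_def intro!: mat_diag_cong)
    qed
    have Pc: "P \<in> carrier_mat M M" by (simp add: P_def)
    have Hinv: "mat_inv Hx = mat_diag N (\<lambda>k. 1 / w k)"
      unfolding Hx' by (rule mat_inv_mat_diag) (use w in force)
    have Rc: "R \<in> carrier_mat N N"
      unfolding R_def B_mat_def Hinv \<sigma>m' cm' mat_diag_sq
      by (rule carrier_matI) (use MN0 in \<open>simp_all add: proj_eq_mat_diag\<close>)
    have Ac: "cm ^\<^sub>m 2 * Dxx \<in> carrier_mat N N"
      unfolding Dxx_def D_xx_def Hinv cm' mat_diag_sq
      by (rule carrier_matI) (use D in simp_all)
    have FG: "F \<in> carrier_vec (M * N)" "G \<in> carrier_vec (M * N)"
      by (simp_all add: F_def G_def lift_init_carrier)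
    have Sb: "Sbar \<in> carrier_vec (M * N)" by (simp add: Sbar_def source_vec_def)
    define X where "X = unvec M N U"
    define Y where "Y = unvec M N V"
    define XF where "XF = unvec M N F"
    define XG where "XG = unvec M N G"
    have carr: "X \<in> carrier_mat M N" "XF \<in> carrier_mat M N" "XG \<in> carrier_mat M N"
      by (simp_all add: X_def XF_def XG_def)
    have kv: "unvec M N ((A \<otimes>\<^sub>K B) *\<^sub>v W) = A * unvec M N W * B\<^sup>T" "(A \<otimes>\<^sub>K B) *\<^sub>v W \<in> carrier_vec (M * N)"
      if "A \<in> carrier_mat M M" "B \<in> carrier_mat N N" "W \<in> carrier_vec (M * N)" for A B W
      using that unvec_kron_mult[OF that] kron_carrier[OF that(1,2)] by auto
    have kv1: "unvec M N ((A \<otimes>\<^sub>K 1\<^sub>m N) *\<^sub>v W) = A * unvec M N W"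
      if "A \<in> carrier_mat M M" "W \<in> carrier_vec (M * N)" for A W
      using kv(1)[OF that(1) one_carrier_mat that(2)] that(1)
      by (simp add: right_mult_one_mat[OF mult_carrier_mat[OF that(1) unvec_carrier]])
    have Y: "Y = Dj * X - \<mu>1 \<cdot>\<^sub>m (P * (X - XF))"
      unfolding Y_def VU aux_field_def PHt X_def XF_def using U FG Pc Dij
      by (simp add: unvec_diff unvec_smult kv1 kv(2))
    have "unvec M N Sbar = 0\<^sub>m M N"
      by (rule eq_rowI) (simp_all add: row_unvec S carrier_matD[OF unvec_carrier])
    \<comment> \<open>Applying \<open>unvec\<close> to both sides of the scheme gives its matrix
      form; the source drops out, and the relations for \<open>\<mu>2\<close> and
      \<open>\<mu>4\<close> are inserted.\<close>
    then have "Di * Dj * X + Dj * X * R\<^sup>T - X * (cm ^\<^sub>m 2 * Dxx)\<^sup>T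
      = \<mu>1 \<cdot>\<^sub>m (P * (X - XF) * R\<^sup>T) + \<mu>1 \<cdot>\<^sub>m (Di * P * (X - XF))
      + \<mu>3 \<cdot>\<^sub>m (P * (Dj * X - XG)) + (- \<mu>1 * \<mu>3) \<cdot>\<^sub>m (P * P * (X - XF))"
      using arg_cong[OF scheme[unfolded fully_discrete_def SAT_def PHt Let_def], of "unvec M N"]
        U FG Pc Dij Rc Ac Sb carr
      by (simp add: unvec_diff unvec_add unvec_smult kv X_def XF_def XG_def assms(3,4)
          mult_carrier_mat[of _ M M _ M] mult_carrier_mat[of _ M M _ N] minus_carrier_mat
          right_mult_one_mat[of _ M N] left_mult_one_mat[of _ M N] right_add_zero_mat[of _ M N])
    \<comment> \<open>Space operators act from the right, so \<open>first_order_form\<close> is used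
      with \<open>R\<^sup>T\<close> in place of \<open>R\<close> and with
      \<open>X * (cm ^\<^sub>m 2 * Dxx)\<^sup>T\<close> in place of \<open>L\<close>.\<close>
    then have "Di * Y - \<mu>3 \<cdot>\<^sub>m (P * (Y - XG)) = X * (cm ^\<^sub>m 2 * Dxx)\<^sup>T - Y * R\<^sup>T"
      by (intro first_order_form[OF Dij Pc carr _ _ Y]) (use carr Rc Ac in auto)
    then have "energy Hx cm (Dm N) (row X (M - 1)) (row Y (M - 1))
        + (\<Sum>k<M. \<tau> k * (sqnorm Hx (mat_inv cm *\<^sub>v (\<sigma>m *\<^sub>v row Y k)) + BT N \<alpha>L \<beta>L \<alpha>R \<beta>R (row Y k)))
        \<le> 2 * (\<mu>1\<^sup>2 / (- 4 * \<mu>1 - 2) + \<mu>3\<^sup>2 / (- 4 * \<mu>3 - 2)) * energy Hx cm (Dm N) f g"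
      unfolding Dxx_def
      by (intro energy_estimate[OF assms(1,2) MN0(2,1) D Dij w \<tau> cc sbp f g carr(1) carr(2) _ carr(3) _
            P_def Hx' cm' \<sigma>m' R_def Y])
        (use f g MN0 in \<open>auto simp: XF_def XG_def F_def G_def unvec_lift_init\<close>)
    then show "energy Hx cm (Dm N) (block N (M - 1) U) (block N (M - 1) V)
          + (\<Sum>k<M. ht M k *
               (sqnorm Hx (mat_inv cm *\<^sub>v (\<sigma>m *\<^sub>v block N k V))
                + BT N \<alpha>L \<beta>L \<alpha>R \<beta>R (block N k V)) * grid_step 0 T M)
        \<le> 2 * (\<mu>1\<^sup>2 / (- 4 * \<mu>1 - 2) + \<mu>3\<^sup>2 / (- 4 * \<mu>3 - 2)) * energy Hx cm (Dm N) f g"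
      using MN0 by (simp add: X_def Y_def row_unvec \<tau>_def mult_ac)
  qed
qed

end
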